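(* Let $\mathcal G$ be a metric graph with metric completion $\overline{\mathcal G}$. If $\overline{\mathcal G}$ is compact, then $\partial\overline{\mathcal G}$ is totally disconnected if and only if $\overline{\mathcal G}$ is weakly connected.
   Context: A metric graph $\mathcal G$ is a connected, locally finite (every vertex has finite degree) graph with countable vertex set and edge set, in which each edge $e$ is assigned a length $l_e$ with $0<l_e<\infty$ and is identified with a real interval $[a_e,b_e]$ of length $l_e$. Lengths of edges and of their subsets extend to lengths of paths by addition, and the distance $d(x_1,x_2)$ between points $x_1,x_2\in\mathcal G$ is the infimum of the lengths of paths joining them. $\overline{\mathcal G}$ denotes the completion of the metric space $(\mathcal G,d)$. The boundary $\partial\mathcal G$ is the set of vertices of degree $1$; the interior $\mathcal G_{int}$ is $\mathcal G\setminus\partial\mathcal G$; and $\partial\overline{\mathcal G}=\overline{\mathcal G}\setminus\mathcal G_{int}$. $\overline{\mathcal G}$ is weakly connected if for every pair of distinct points $x,y\in\overline{\mathcal G}$ there is a finite set $W=\{w_1,\dots,w_K\}$ of points of $\mathcal G$ (not necessarily vertices) and disjoint open sets $U,V\subset\overline{\mathcal G}$ with $x\in U$, $y\in V$ and $\overline{\mathcal G}\setminus W=U\cup V$. *)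

theory Defs
  imports "HOL-Analysis.Analysis" "Graph_Theory.Digraph_Component"
begin

section \<open>Metric graphs\<close>

text \<open>
  The underlying graph may have loops and parallel edges. An edge \<open>e\<close> is identified with the
  interval \<open>[a e, b e]\<close>, whose left end is glued to \<open>tail G e\<close> and whose right end is glued to
  \<open>head G e\<close>; the direction of an arc has no other meaning. Accordingly connectedness is
  connectedness of the underlying undirected graph.
\<close>

locale metric_graph = wf_digraph G
  for G :: "('v, 'e) pre_digraph" +
  fixes a b :: "'e \<Rightarrow> real"
  assumes connected: "Digraph_Component.connected G"
    and locally_finite:
      "\<And>v. v \<in> verts G \<Longrightarrow> finite (in_arcs G v) \<and> finite (out_arcs G v)"
    and countable_verts: "countable (verts G)"
    and countable_arcs: "countable (arcs G)"
    and length_pos: "\<And>e. e \<in> arcs G \<Longrightarrow> a e < b e"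

text \<open>
  Canonical representatives for the points of the disjoint union of the intervals \<open>[a e, b e]\<close>
  modulo the identification of endpoints at common vertices.
\<close>

datatype ('v, 'e) graph_point = Vertex 'v | Inner 'e real

context metric_graph
begin

text \<open>The quotient map restricted to the interval \<open>[a e, b e]\<close>.\<close>

definition edge_point :: "'e \<Rightarrow> real \<Rightarrow> ('v, 'e) graph_point" where
  "edge_point e t =
     (if t = a e then Vertex (tail G e) else if t = b e then Vertex (head G e) else Inner e t)"

definition points :: "('v, 'e) graph_point set" where
  "points = Vertex ` verts G \<union> (\<Union>e\<in>arcs G. edge_point e ` {a e..b e})"

text \<open>
  A path is a finite list of segments; \<open>(e, s, t)\<close> runs along the edge \<open>e\<close> from parameter \<open>s\<close>
  to parameter \<open>t\<close>, in either direction.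
\<close>

primrec joins ::
  "('e \<times> real \<times> real) list \<Rightarrow> ('v, 'e) graph_point \<Rightarrow> ('v, 'e) graph_point \<Rightarrow> bool" where
  "joins [] x y \<longleftrightarrow> x = y"
| "joins (seg # p) x y \<longleftrightarrow>
     (case seg of (e, s, t) \<Rightarrow>
        e \<in> arcs G \<and> s \<in> {a e..b e} \<and> t \<in> {a e..b e} \<and>
        x = edge_point e s \<and> joins p (edge_point e t) y)"

definition path_length :: "('e \<times> real \<times> real) list \<Rightarrow> real" where
  "path_length p = (\<Sum>(e, s, t) \<leftarrow> p. \<bar>t - s\<bar>)"

text \<open>The value 0 off \<open>points\<close> is a dummy that \<open>Metric_space\<close> requires.\<close>

definition graph_dist :: "('v, 'e) graph_point \<Rightarrow> ('v, 'e) graph_point \<Rightarrow> real" where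
  "graph_dist x y =
     (if x \<in> points \<and> y \<in> points then Inf (path_length ` {p. joins p x y}) else 0)"

definition graph_metric :: "('v, 'e) graph_point metric" where
  "graph_metric = metric (points, graph_dist)"

text \<open>A loop contributes 2 to the degree of its vertex.\<close>

definition degree :: "'v \<Rightarrow> nat" where
  "degree v = in_degree G v + out_degree G v"

definition graph_boundary :: "('v, 'e) graph_point set" where
  "graph_boundary = Vertex ` {v \<in> verts G. degree v = 1}"

definition graph_interior :: "('v, 'e) graph_point set" where
  "graph_interior = points - graph_boundary"

end

section \<open>The distance is a metric\<close>

context metric_graph
begin

lemma edge_point_in_points:
  "e \<in> arcs G \<Longrightarrow> s \<in> {a e..b e} \<Longrightarrow> edge_point e s \<in> points"
  unfolding points_def by blast

lemma path_length_Nil [simp]: "path_length [] = 0"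
  by (simp add: path_length_def)

lemma path_length_Cons [simp]: "path_length ((e, s, t) # p) = \<bar>t - s\<bar> + path_length p"
  by (simp add: path_length_def)

lemma path_length_append [simp]: "path_length (p @ q) = path_length p + path_length q"
  by (simp add: path_length_def)

lemma path_length_nonneg [simp]: "0 \<le> path_length p"
  by (induction p) auto

lemma joins_append: "joins p x y \<Longrightarrow> joins q y z \<Longrightarrow> joins (p @ q) x z"
  by (induction p arbitrary: x) auto

lemma joins_reverse: "joins p x y \<Longrightarrow> \<exists>q. joins q y x \<and> path_length q = path_length p"
proof (induction p arbitrary: x)
  case Nil
  then show ?case by (intro exI[of _ "[]"]) simp
next
  case (Cons seg p)
  obtain e s t where seg: "seg = (e, s, t)" by (cases seg)
  with Cons.prems have h: "e \<in> arcs G" "s \<in> {a e..b e}" "t \<in> {a e..b e}"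
    "x = edge_point e s" "joins p (edge_point e t) y" by auto
  from Cons.IH[OF h(5)] obtain q
    where q: "joins q y (edge_point e t)" "path_length q = path_length p" by blast
  have "joins [(e, t, s)] (edge_point e t) x" using h by auto
  with q have "joins (q @ [(e, t, s)]) y x" by (blast intro: joins_append)
  moreover have "path_length (q @ [(e, t, s)]) = path_length (seg # p)"
    using q seg by auto
  ultimately show ?case by blast
qed

lemma joins_arc:
  assumes "e \<in> arcs G"
  shows "joins [(e, a e, b e)] (Vertex (tail G e)) (Vertex (head G e))"
    and "joins [(e, b e, a e)] (Vertex (head G e)) (Vertex (tail G e))"
  using assms length_pos[OF assms] by (auto simp: edge_point_def)

lemma joins_verts:
  assumes "u \<in> verts G" "v \<in> verts G"
  shows "\<exists>p. joins p (Vertex u) (Vertex v)"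
proof -
  have "strongly_connected (mk_symmetric G)"
    using connected by (simp add: Digraph_Component.connected_def)
  with assms have "u \<rightarrow>\<^sup>*\<^bsub>mk_symmetric G\<^esub> v"
    by (auto simp: strongly_connected_def)
  then have "(u, v) \<in> rtrancl_on (verts G) (parcs (mk_symmetric G))"
    by (simp add: reachable_def arcs_ends_conv)
  then show ?thesis
  proof (induction rule: rtrancl_on_induct)
    case base
    have "joins [] (Vertex u) (Vertex u)" by simp
    then show ?case by blast
  next
    case (step y z)
    then obtain e where "e \<in> arcs G"
      "y = tail G e \<and> z = head G e \<or> y = head G e \<and> z = tail G e"
      by (auto simp: parcs_mk_symmetric)
    with step.IH joins_arc show ?case by (blast intro: joins_append)
  qed
qed

lemma joins_vertex:
  assumes "x \<in> points"
  shows "\<exists>p. \<exists>v\<in>verts G. joins p x (Vertex v)"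
proof -
  consider v where "v \<in> verts G" "x = Vertex v"
    | e s where "e \<in> arcs G" "s \<in> {a e..b e}" "x = edge_point e s"
    using assms by (auto simp: points_def)
  then show ?thesis
  proof cases
    case 1
    then have "joins [] x (Vertex v)" by simp
    with 1 show ?thesis by blast
  next
    case 2
    then have "joins [(e, s, a e)] x (Vertex (tail G e))"
      using length_pos[of e] by (auto simp: edge_point_def)
    with 2 show ?thesis using tail_in_verts by blast
  qed
qed

lemma joins_points:
  assumes "x \<in> points" "y \<in> points"
  shows "\<exists>p. joins p x y"
  using joins_vertex[OF assms(1)] joins_vertex[OF assms(2)]
  by (meson joins_append joins_reverse joins_verts)

lemma graph_dist_le:
  assumes "joins p x y"
  shows "graph_dist x y \<le> path_length p"
proof -
  have "Inf (path_length ` {p. joins p x y}) \<le> path_length p"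
    using assms by (intro cInf_lower) (auto intro!: bdd_belowI[where m = 0])
  then show ?thesis by (simp add: graph_dist_def)
qed

lemma graph_dist_ge:
  assumes "x \<in> points" "y \<in> points" "\<And>p. joins p x y \<Longrightarrow> c \<le> path_length p"
  shows "c \<le> graph_dist x y"
proof -
  have "c \<le> Inf (path_length ` {p. joins p x y})"
    using assms joins_points[OF assms(1,2)] by (intro cInf_greatest) auto
  with assms show ?thesis by (simp add: graph_dist_def)
qed

lemma lipschitz_path:
  assumes "\<And>e s t. e \<in> arcs G \<Longrightarrow> s \<in> {a e..b e} \<Longrightarrow> t \<in> {a e..b e} \<Longrightarrow>
    f (edge_point e s) - f (edge_point e t) \<le> \<bar>t - s\<bar>"
  shows "joins p x y \<Longrightarrow> f x - f y \<le> path_length p"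
proof (induction p arbitrary: x)
  case (Cons seg p)
  obtain e s t where "seg = (e, s, t)" by (cases seg)
  with Cons.prems Cons.IH[of "edge_point e t"] assms[of e s t] show ?case by auto
qed auto

lemma graph_dist_pos:
  assumes x: "x \<in> points" and y: "y \<in> points" and ne: "x \<noteq> y"
  shows "0 < graph_dist x y"
proof -
  have "\<exists>f :: _ \<Rightarrow> real. f y < f x \<and> (\<forall>e\<in>arcs G. \<forall>s\<in>{a e..b e}. \<forall>t\<in>{a e..b e}.
    f (edge_point e s) - f (edge_point e t) \<le> \<bar>t - s\<bar>)"
  proof (cases x)
    case (Inner e0 t0)
    then have e0: "e0 \<in> arcs G" "a e0 < t0" "t0 < b e0"
      using x by (auto simp: points_def edge_point_def less_le split: if_splits)
    define r where "r = min (t0 - a e0) (b e0 - t0)"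
    define f :: "('v, 'e) graph_point \<Rightarrow> real" where
      "f z = (case z of Vertex v \<Rightarrow> 0
                | Inner e t \<Rightarrow> if e = e0 then max 0 (r - \<bar>t - t0\<bar>) else 0)" for z
    have "f (edge_point e s) = (if e = e0 then max 0 (r - \<bar>s - t0\<bar>) else 0)"
      if "s \<in> {a e..b e}" for e s
      using that e0 by (auto simp: f_def edge_point_def r_def)
    moreover have "f y < f x"
      using Inner ne e0 by (auto simp: f_def r_def split: graph_point.splits)
    ultimately show ?thesis by (intro exI[of _ f]) auto
  next
    case (Vertex v)
    then have v: "v \<in> verts G"
      using x by (auto simp: points_def edge_point_def split: if_splits)
    define I where "I = in_arcs G v \<union> out_arcs G v"
    define r where "r = Min (insert 1 ((\<lambda>e. b e - a e) ` I))"
    have "finite I" using locally_finite[OF v] by (simp add: I_def)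
    then have r: "0 < r" "\<And>e. e \<in> I \<Longrightarrow> r \<le> b e - a e"
      using length_pos by (auto simp: r_def I_def)
    define g where "g e t = max 0 (max (if tail G e = v then r - (t - a e) else 0)
      (if head G e = v then r - (b e - t) else 0))" for e t
    define f :: "('v, 'e) graph_point \<Rightarrow> real" where
      "f z = (case z of Vertex w \<Rightarrow> if w = v then r else 0 | Inner e t \<Rightarrow> g e t)" for z
    have fg: "f (edge_point e s) = g e s" if "e \<in> arcs G" "s \<in> {a e..b e}" for e s
      using that r(1) r(2)[of e] by (auto simp: f_def g_def edge_point_def I_def)
    have "g e s - g e t \<le> \<bar>t - s\<bar>" for e s t
      by (auto simp: g_def)
    moreover have "f y < f x"
    proof (cases y)
      case (Vertex w)
      with \<open>x = Vertex v\<close> ne r show ?thesis by (auto simp: f_def)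
    next
      case (Inner e t)
      then have "a e < t" "t < b e"
        using y by (auto simp: points_def edge_point_def less_le split: if_splits)
      with Inner \<open>x = Vertex v\<close> r show ?thesis by (auto simp: f_def g_def)
    qed
    ultimately show ?thesis by (intro exI[of _ f]) (auto simp: fg)
  qed
  then obtain f :: "_ \<Rightarrow> real" where "f y < f x" and f: "\<And>e s t. e \<in> arcs G \<Longrightarrow>
    s \<in> {a e..b e} \<Longrightarrow> t \<in> {a e..b e} \<Longrightarrow> f (edge_point e s) - f (edge_point e t) \<le> \<bar>t - s\<bar>"
    by blast
  have "f x - f y \<le> graph_dist x y"
    using x y lipschitz_path[of f, OF f] by (intro graph_dist_ge) auto
  with \<open>f y < f x\<close> show ?thesis by simp
qed

lemma graph_dist_commute_le:
  assumes "x \<in> points" "y \<in> points"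
  shows "graph_dist x y \<le> graph_dist y x"
  using assms by (intro graph_dist_ge) (metis joins_reverse graph_dist_le)+

lemma graph_dist_triangle:
  assumes x: "x \<in> points" and y: "y \<in> points" and z: "z \<in> points"
  shows "graph_dist x z \<le> graph_dist x y + graph_dist y z"
proof -
  have "graph_dist x z - path_length q \<le> graph_dist x y" if "joins q y z" for q
    using x y
  proof (rule graph_dist_ge)
    fix p assume "joins p x y"
    with that have "graph_dist x z \<le> path_length (p @ q)"
      by (blast intro: joins_append graph_dist_le)
    then show "graph_dist x z - path_length q \<le> path_length p" by simp
  qed
  then have "graph_dist x z - graph_dist x y \<le> graph_dist y z"
    using y z by (intro graph_dist_ge) (auto simp: algebra_simps)
  then show ?thesis by simp
qed

lemma Metric_space_graph_dist: "Metric_space points graph_dist"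
proof
  show "0 \<le> graph_dist x y" for x y
  proof (cases "x \<in> points \<and> y \<in> points")
    case True
    then show ?thesis by (intro graph_dist_ge) auto
  qed (auto simp: graph_dist_def)
  show "graph_dist x y = graph_dist y x" for x y
  proof (cases "x \<in> points \<and> y \<in> points")
    case True
    then show ?thesis by (intro antisym graph_dist_commute_le) auto
  qed (auto simp: graph_dist_def)
  show "graph_dist x y = 0 \<longleftrightarrow> x = y" if "x \<in> points" "y \<in> points" for x y
  proof
    assume "graph_dist x y = 0"
    with graph_dist_pos[OF that] show "x = y" by force
  next
    assume "x = y"
    then have "joins [] x y" by simp
    from graph_dist_le[OF this] have "graph_dist x y \<le> 0" by simp
    moreover have "0 \<le> graph_dist x y" using that by (intro graph_dist_ge) auto
    ultimately show "graph_dist x y = 0" by simp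
  qed
qed (rule graph_dist_triangle)

lemma mspace_graph_metric [simp]: "mspace graph_metric = points"
  and mdist_graph_metric [simp]: "mdist graph_metric = graph_dist"
  by (simp_all add: graph_metric_def Metric_space.mspace_metric Metric_space.mdist_metric
      Metric_space_graph_dist)

end

section \<open>Completion, boundary and connectivity\<close>

text \<open>
  A completion is given by a complete metric space and an isometric embedding with dense image;
  it is determined up to isometry.
\<close>

definition is_completion :: "'p metric \<Rightarrow> 'c metric \<Rightarrow> ('p \<Rightarrow> 'c) \<Rightarrow> bool" where
  "is_completion m c \<iota> \<longleftrightarrow>
     mcomplete_of c \<and>
     \<iota> \<in> mspace m \<rightarrow> mspace c \<and>
     (\<forall>x\<in>mspace m. \<forall>y\<in>mspace m. mdist c (\<iota> x) (\<iota> y) = mdist m x y) \<and>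
     mtopology_of c closure_of (\<iota> ` mspace m) = mspace c"

lemma is_completion_exists:
  fixes m :: "'p metric"
  shows "\<exists>(c :: ('p \<Rightarrow> real) metric) \<iota>. is_completion m c \<iota>"
proof -
  obtain \<iota> :: "'p \<Rightarrow> 'p \<Rightarrow> real" and c where "mcomplete_of c" "\<iota> \<in> mspace m \<rightarrow> mspace c"
    "mtopology_of c closure_of \<iota> ` mspace m = mspace c"
    "\<And>x y. x \<in> mspace m \<Longrightarrow> y \<in> mspace m \<Longrightarrow> mdist c (\<iota> x) (\<iota> y) = mdist m x y"
    by (rule Metric_space.metric_completion[OF Metric_space_mspace_mdist[of m]]) blast
  then have "is_completion m c \<iota>" by (simp add: is_completion_def)
  then show ?thesis by blast
qed

definition totally_disconnected_space :: "'c topology \<Rightarrow> bool" where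
  "totally_disconnected_space X \<longleftrightarrow> (\<forall>C\<in>connected_components_of X. \<exists>x. C = {x})"

context metric_graph
begin

definition completion_boundary ::
  "'c metric \<Rightarrow> (('v, 'e) graph_point \<Rightarrow> 'c) \<Rightarrow> 'c set" where
  "completion_boundary Gbar \<iota> = mspace Gbar - \<iota> ` graph_interior"

definition weakly_connected ::
  "'c metric \<Rightarrow> (('v, 'e) graph_point \<Rightarrow> 'c) \<Rightarrow> bool" where
  "weakly_connected Gbar \<iota> \<longleftrightarrow>
     (\<forall>x\<in>mspace Gbar. \<forall>y\<in>mspace Gbar. x \<noteq> y \<longrightarrow>
        (\<exists>W U V. finite W \<and> W \<subseteq> \<iota> ` points \<and>
           openin (mtopology_of Gbar) U \<and> openin (mtopology_of Gbar) V \<and> U \<inter> V = {} \<and>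
           x \<in> U \<and> y \<in> V \<and> mspace Gbar - W = U \<union> V))"

end

end

theory Submission
  imports Defs
begin

text \<open>
  Local finiteness makes a small closed ball around a point of the graph a finite union of
  segments. It is compact, so the completion adds no point to it, and its sphere is finite. Hence
  every point of the graph has arbitrarily small neighbourhoods in the completion with a finite
  frontier in the graph; in particular the boundary \<open>B\<close> is closed and its points in the graph are
  isolated in \<open>B\<close>.

  If \<open>B\<close> is totally disconnected, two of its points lie in complementary clopen subsets \<open>P\<close>, \<open>Q\<close>
  of \<open>B\<close>. By normality there is an open \<open>N\<close> containing \<open>P\<close> whose closure misses \<open>Q\<close>. Its
  frontier is compact and lies in the graph, so finitely many neighbourhoods with finite frontier
  cover it; adding them to \<open>N\<close> leaves only a finite frontier, which separates the two points.
  Conversely, a connected subset of \<open>B\<close> with two points avoids the isolated points, hence every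
  finite subset of the graph, and so cannot be cut.
\<close>

section \<open>Separation by finite sets\<close>

text \<open>Weak connectedness for a single pair of points, with the graph replaced by an arbitrary
  set \<open>S\<close>. The equivalence can thus be proved for topological spaces, apart from any
  metric.\<close>

definition finitely_separated :: "'a topology \<Rightarrow> 'a set \<Rightarrow> 'a \<Rightarrow> 'a \<Rightarrow> bool" where
  "finitely_separated X S x y \<longleftrightarrow>
     (\<exists>W U V. finite W \<and> W \<subseteq> S \<and> openin X U \<and> openin X V \<and> U \<inter> V = {} \<and>
        x \<in> U \<and> y \<in> V \<and> topspace X - W = U \<union> V)"

lemma finitely_separated_sym: "finitely_separated X S x y \<Longrightarrow> finitely_separated X S y x"
  unfolding finitely_separated_def by (metis Int_commute Un_commute)

text \<open>The frontier of \<open>U\<close> itself serves as the cutting set: removing it leaves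
  the open set \<open>U\<close> and its exterior.\<close>

lemma finitely_separated_frontier:
  assumes U: "openin X U" "finite (X frontier_of U)" "X frontier_of U \<subseteq> S"
    and x: "x \<in> U" and y: "y \<in> topspace X" "y \<notin> X closure_of U"
  shows "finitely_separated X S x y"
proof -
  have sub: "U \<subseteq> X closure_of U" "X closure_of U \<subseteq> topspace X"
    using U(1) closure_of_subset openin_subset closure_of_subset_topspace by metis+
  have "X frontier_of U = X closure_of U - U"
    using U(1) by (rule frontier_of_openin)
  then have "topspace X - X frontier_of U = U \<union> (topspace X - X closure_of U)"
    using sub by blast
  moreover have "openin X (topspace X - X closure_of U)"
    using closedin_closure_of openin_diff openin_topspace by metis
  moreover have "U \<inter> (topspace X - X closure_of U) = {}" using sub by blast
  moreover have "y \<in> topspace X - X closure_of U" using y by blast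
  ultimately show ?thesis
    unfolding finitely_separated_def using U x by blast
qed

text \<open>Choosing the neighbourhood of \<open>z\<close> inside one of two disjoint open sets
  around \<open>z\<close> and \<open>y\<close> keeps \<open>y\<close> out of its closure, as the
  preceding criterion demands.\<close>

lemma finite_frontier_avoiding:
  assumes "Hausdorff_space X" and y: "y \<in> topspace X" and z: "z \<in> topspace X" "z \<noteq> y"
    and base: "\<And>Q. openin X Q \<Longrightarrow> z \<in> Q \<Longrightarrow>
      \<exists>U. openin X U \<and> z \<in> U \<and> U \<subseteq> Q \<and> finite (X frontier_of U) \<and> X frontier_of U \<subseteq> S"
  obtains U where "openin X U" "z \<in> U" "y \<notin> X closure_of U"
    "finite (X frontier_of U)" "X frontier_of U \<subseteq> S"
proof -
  obtain Q R where QR: "openin X Q" "openin X R" "z \<in> Q" "y \<in> R" "disjnt Q R"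
    using assms unfolding Hausdorff_space_def by metis
  obtain U where U: "openin X U" "z \<in> U" "U \<subseteq> Q" "finite (X frontier_of U)" "X frontier_of U \<subseteq> S"
    using base[OF QR(1,3)] by blast
  have "y \<notin> X closure_of U"
    using QR U(3) unfolding in_closure_of disjnt_iff by blast
  with U that show ?thesis by blast
qed

text \<open>In a compact Hausdorff space the connected components are the quasi-components, so
  points in different components are split by a clopen set.\<close>

lemma totally_disconnected_space_imp_clopen:
  assumes "totally_disconnected_space Y" "compact_space Y" "Hausdorff_space Y"
    and "x \<in> topspace Y" "y \<in> topspace Y" "x \<noteq> y"
  obtains T where "closedin Y T" "openin Y T" "x \<in> T" "y \<notin> T"
proof -
  have "\<not> connected_component_of Y x y"
  proof
    assume xy: "connected_component_of Y x y"
    have "connected_component_of_set Y x \<in> connected_components_of Y"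
      using assms connected_component_in_connected_components_of by metis
    then obtain c where "connected_component_of_set Y x = {c}"
      using assms(1) unfolding totally_disconnected_space_def by blast
    moreover have "connected_component_of Y x x"
      using assms connected_component_of_refl by metis
    ultimately show False using xy \<open>x \<noteq> y\<close> by (metis mem_Collect_eq singletonD)
  qed
  then have "\<not> quasi_component_of Y x y"
    using quasi_eq_connected_component_of[of Y x] assms by simp
  then obtain T where T: "closedin Y T" "openin Y T" "x \<in> T \<longleftrightarrow> y \<notin> T"
    using assms unfolding quasi_component_of_def by blast
  \<comment> \<open>The clopen set may contain either of the two points; in the second case its
    complement is taken.\<close>
  show ?thesis
  proof (cases "x \<in> T")
    case True
    with T that show ?thesis by blast
  next
    case False
    have "closedin Y (topspace Y - T)" "openin Y (topspace Y - T)"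
      using T by blast+
    with False T assms that show ?thesis by blast
  qed
qed

lemma totally_disconnected_spaceI:
  assumes "\<And>C x y. connectedin Y C \<Longrightarrow> x \<in> C \<Longrightarrow> y \<in> C \<Longrightarrow> x = y"
  shows "totally_disconnected_space Y"
  unfolding totally_disconnected_space_def
proof
  fix C assume C: "C \<in> connected_components_of Y"
  then obtain x where "x \<in> C" using nonempty_connected_components_of by blast
  moreover have "connectedin Y C" using C connectedin_connected_components_of by blast
  ultimately have "C = {x}" using assms by blast
  then show "\<exists>x. C = {x}" ..
qed

lemma finitely_separated_of_clopen:
  assumes X: "compact_space X" "Hausdorff_space X"
    and B: "closedin X B" "topspace X - B \<subseteq> S"
    and base: "\<And>z Q. z \<in> topspace X - B \<Longrightarrow> openin X Q \<Longrightarrow> z \<in> Q \<Longrightarrow>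
      \<exists>U. openin X U \<and> z \<in> U \<and> U \<subseteq> Q \<and> finite (X frontier_of U) \<and> X frontier_of U \<subseteq> S"
    and T: "closedin (subtopology X B) T" "openin (subtopology X B) T"
    and x: "x \<in> T" and y: "y \<in> B" "y \<notin> T"
  shows "finitely_separated X S x y"
proof -
  have BX: "B \<subseteq> topspace X" using B closedin_subset by blast
  \<comment> \<open>\<open>T\<close> is clopen only relative to \<open>B\<close>. Since
    \<open>B\<close> is closed, both \<open>T\<close> and \<open>B - T\<close> are closed in
    \<open>X\<close>, and normality applies to them.\<close>
  have "closedin X T" using T(1) B(1) closedin_trans_full by blast
  moreover have "closedin X (B - T)"
    using T(2) B(1) BX by (metis closedin_def closedin_diff closedin_topspace closedin_trans_full
        topspace_subtopology_subset)
  moreover have "normal_space X"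
    using X compact_Hausdorff_or_regular_imp_normal_space by blast
  moreover have "disjnt T (B - T)" by (auto simp: disjnt_iff)
  ultimately obtain N where N: "openin X N" "T \<subseteq> N" "disjnt (B - T) (X closure_of N)"
    unfolding normal_space by meson
  define K where "K = X frontier_of N"
  have K: "K = X closure_of N - N" using N frontier_of_openin unfolding K_def by blast
  \<comment> \<open>The frontier avoids \<open>T\<close>, which lies in the open set
    \<open>N\<close>, and avoids \<open>B - T\<close>, which misses the closure of
    \<open>N\<close>.\<close>
  have KX: "K \<subseteq> topspace X - B"
    using N frontier_of_subset_topspace[of X N] unfolding K K_def[symmetric]
    by (auto simp: disjnt_iff dest: in_closure_of[THEN iffD1])
  have "compactin X K"
    using X(1) closedin_frontier_of closedin_compact_space unfolding K_def by blast
  have yX: "y \<in> topspace X" using y BX by blast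
  \<comment> \<open>Excluding \<open>y\<close> from each closure ensures that \<open>y\<close> stays
    outside the closure of \<open>N\<close> after finitely many of these sets are added.\<close>
  define \<U> where "\<U> = {U. openin X U \<and> y \<notin> X closure_of U \<and>
    finite (X frontier_of U) \<and> X frontier_of U \<subseteq> S}"
  have "K \<subseteq> \<Union>\<U>"
  proof
    fix z assume z: "z \<in> K"
    then have zB: "z \<in> topspace X - B" and zX: "z \<in> topspace X" "z \<noteq> y" using KX y by auto
    obtain U where "openin X U" "z \<in> U" "y \<notin> X closure_of U"
      "finite (X frontier_of U)" "X frontier_of U \<subseteq> S"
      by (rule finite_frontier_avoiding[OF X(2) yX zX base[OF zB]])
    then have "U \<in> \<U>" "z \<in> U" by (simp_all add: \<U>_def)
    then show "z \<in> \<Union>\<U>" by blast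
  qed
  then obtain \<F> where \<F>: "finite \<F>" "\<F> \<subseteq> \<U>" "K \<subseteq> \<Union>\<F>"
    using \<open>compactin X K\<close> unfolding compactin_def \<U>_def by (metis (no_types, lifting) mem_Collect_eq)
  define M where "M = \<Union>\<F>"
  have clM: "X closure_of M = (\<Union>U\<in>\<F>. X closure_of U)"
    unfolding M_def using \<F>(1) closure_of_Union by blast
  have frM: "X frontier_of M \<subseteq> (\<Union>U\<in>\<F>. X frontier_of U)"
    unfolding M_def using \<F>(1) frontier_of_Union_subset by blast
  have oM: "openin X M" using \<F> unfolding M_def \<U>_def by blast
  have oU: "openin X (N \<union> M)" using N oM by blast
  \<comment> \<open>A point of the closure of \<open>N\<close> outside \<open>N\<close> lies in
    \<open>K\<close>, hence in \<open>M\<close>. So the possibly infinite frontier of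
    \<open>N\<close> is absorbed and only that of \<open>M\<close> can remain.\<close>
  have "X frontier_of (N \<union> M) \<subseteq> X frontier_of M"
    using frontier_of_openin[OF oU] frontier_of_openin[OF oM] \<F>(3) K by (auto simp: M_def)
  with frM have fr: "X frontier_of (N \<union> M) \<subseteq> (\<Union>U\<in>\<F>. X frontier_of U)" by blast
  moreover have "finite (\<Union>U\<in>\<F>. X frontier_of U)" "(\<Union>U\<in>\<F>. X frontier_of U) \<subseteq> S"
    using \<F> unfolding \<U>_def by blast+
  ultimately have "finite (X frontier_of (N \<union> M))" "X frontier_of (N \<union> M) \<subseteq> S"
    using finite_subset by blast+
  moreover have "y \<notin> X closure_of (N \<union> M)"
    using N(3) y \<F>(2) by (auto simp: clM disjnt_iff \<U>_def)
  moreover have "x \<in> N \<union> M" using x N by blast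
  ultimately show ?thesis using finitely_separated_frontier oU yX by metis
qed

text \<open>\<open>S\<close> stands for the graph and \<open>B\<close> for the boundary of its
  completion. They may overlap, as they do in vertices of degree 1; \<open>isolated\<close> controls
  this overlap in the converse direction, while \<open>base\<close> supplies the cuts in the forward
  direction.\<close>

theorem totally_disconnected_iff_finitely_separated:
  assumes X: "compact_space X" "Hausdorff_space X"
    and B: "closedin X B" "topspace X - B \<subseteq> S" and S: "S \<subseteq> topspace X"
    and base: "\<And>z Q. z \<in> S \<Longrightarrow> openin X Q \<Longrightarrow> z \<in> Q \<Longrightarrow>
      \<exists>U. openin X U \<and> z \<in> U \<and> U \<subseteq> Q \<and> finite (X frontier_of U) \<and> X frontier_of U \<subseteq> S"
    and isolated: "\<And>z. z \<in> S \<inter> B \<Longrightarrow> \<exists>U. openin X U \<and> U \<inter> B = {z}"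
  shows "totally_disconnected_space (subtopology X B) \<longleftrightarrow>
    (\<forall>x\<in>topspace X. \<forall>y\<in>topspace X. x \<noteq> y \<longrightarrow> finitely_separated X S x y)"
proof
  assume td: "totally_disconnected_space (subtopology X B)"
  \<comment> \<open>A pair with a point in \<open>S\<close> is cut by one small neighbourhood of
    that point. Every other pair lies in \<open>B\<close>, where total disconnectedness provides the
    clopen splitting.\<close>
  have sep1: "finitely_separated X S x y"
    if xy: "x \<in> S" "y \<in> topspace X" "x \<noteq> y" for x y
  proof -
    have "x \<in> topspace X" using xy S by blast
    then obtain U where "openin X U" "x \<in> U" "y \<notin> X closure_of U"
      "finite (X frontier_of U)" "X frontier_of U \<subseteq> S"
      by (rule finite_frontier_avoiding[OF X(2) xy(2) _ xy(3) base[OF xy(1)]])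
    then show ?thesis using finitely_separated_frontier xy(2) by metis
  qed
  have sep2: "finitely_separated X S x y" if xy: "x \<in> B" "y \<in> B" "x \<noteq> y" for x y
  proof -
    have top: "topspace (subtopology X B) = B"
      using closedin_subset[OF B(1)] by (rule topspace_subtopology_subset)
    have "compact_space (subtopology X B)"
      using closedin_compact_space[OF X(1) B(1)] by (rule compact_space_subtopology)
    moreover have "Hausdorff_space (subtopology X B)"
      using X(2) by (rule Hausdorff_space_subtopology)
    moreover have "x \<in> topspace (subtopology X B)" "y \<in> topspace (subtopology X B)"
      unfolding top using xy by blast+
    ultimately obtain T where T: "closedin (subtopology X B) T" "openin (subtopology X B) T"
      "x \<in> T" "y \<notin> T"
      using xy(3) by (rule totally_disconnected_space_imp_clopen[OF td])
    show ?thesis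
    proof (rule finitely_separated_of_clopen[OF X B _ T(1,2,3) xy(2) T(4)])
      fix z Q assume "z \<in> topspace X - B" "openin X Q" "z \<in> Q"
      moreover from this have "z \<in> S" using B(2) by blast
      ultimately show "\<exists>U. openin X U \<and> z \<in> U \<and> U \<subseteq> Q \<and> finite (X frontier_of U) \<and>
          X frontier_of U \<subseteq> S"
        using base by simp
    qed
  qed
  show "\<forall>x\<in>topspace X. \<forall>y\<in>topspace X. x \<noteq> y \<longrightarrow> finitely_separated X S x y"
  proof (intro ballI impI)
    fix x y assume "x \<in> topspace X" "y \<in> topspace X" "x \<noteq> y"
    then show "finitely_separated X S x y"
      using sep1[of x y] sep1[of y x] sep2[of x y] finitely_separated_sym[of X S y x] B(2) by blast
  qed
next
  assume sep: "\<forall>x\<in>topspace X. \<forall>y\<in>topspace X. x \<noteq> y \<longrightarrow> finitely_separated X S x y"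
  show "totally_disconnected_space (subtopology X B)"
  proof (rule totally_disconnected_spaceI, rule ccontr)
    fix C x y
    assume C': "connectedin (subtopology X B) C" and xy: "x \<in> C" "y \<in> C" "x \<noteq> y"
    from C' have C: "connectedin X C" "C \<subseteq> B" "C \<subseteq> topspace X"
      using connectedin_subset_topspace by (auto simp: connectedin_subtopology)
    \<comment> \<open>If \<open>z\<close> were in \<open>C\<close>, then \<open>{z}\<close> would be
      open in \<open>C\<close> by isolation and closed by the Hausdorff property, although
      \<open>C\<close> is connected and has a second point.\<close>
    have CS: "z \<notin> C" if "z \<in> S" for z
    proof
      assume z: "z \<in> C"
      then obtain U where U: "openin X U" "U \<inter> B = {z}"
        using isolated \<open>z \<in> S\<close> C(2) by blast
      have "closedin X {z}"
        using X(2) z C(3) by (simp add: closedin_Hausdorff_sing_eq subset_iff)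
      then have V: "openin X (topspace X - {z})" by blast
      obtain w where "w \<in> C" "w \<noteq> z" using xy by metis
      then have "C \<subseteq> U \<union> (topspace X - {z})" "U \<inter> (topspace X - {z}) \<inter> C = {}"
        "U \<inter> C \<noteq> {}" "(topspace X - {z}) \<inter> C \<noteq> {}"
        using z U C(2,3) by blast+
      with C(1) U(1) V show False unfolding connectedin by metis
    qed
    have "finitely_separated X S x y" using sep xy C(3) by blast
    then obtain W U V where "W \<subseteq> S" "openin X U" "openin X V" "U \<inter> V = {}" "x \<in> U" "y \<in> V"
      "topspace X - W = U \<union> V"
      unfolding finitely_separated_def by auto
    \<comment> \<open>The cutting set lies in \<open>S\<close>, so it removes nothing from
      \<open>C\<close>; the two sides then disconnect \<open>C\<close>.\<close>
    moreover have "C \<subseteq> topspace X - W" using CS C(3) \<open>W \<subseteq> S\<close> by blast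
    ultimately have "C \<subseteq> U \<union> V" "U \<inter> V \<inter> C = {}" "U \<inter> C \<noteq> {}" "V \<inter> C \<noteq> {}"
      using xy by auto
    with C(1) \<open>openin X U\<close> \<open>openin X V\<close> show False unfolding connectedin by metis
  qed
qed

section \<open>Stars in a metric graph\<close>

context metric_graph
begin

text \<open>The preimages of \<open>z\<close> in the disjoint union of the edges. At a vertex their
  number is the degree, a loop being counted at both ends.\<close>

definition charts :: "('v, 'e) graph_point \<Rightarrow> ('e \<times> real) set" where
  "charts z = {(e, s). e \<in> arcs G \<and> s \<in> {a e..b e} \<and> edge_point e s = z}"

text \<open>At a vertex this is local finiteness; an inner point has at most one preimage.\<close>

lemma finite_charts:
  assumes "z \<in> points"
  shows "finite (charts z)"
proof (cases z)
  case (Vertex v)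
  then have v: "v \<in> verts G"
    using assms by (auto simp: points_def edge_point_def split: if_splits)
  have "charts z \<subseteq> (\<lambda>e. (e, a e)) ` out_arcs G v \<union> (\<lambda>e. (e, b e)) ` in_arcs G v"
    using Vertex by (auto simp: charts_def edge_point_def split: if_splits)
  then show ?thesis using locally_finite[OF v] finite_subset by blast
next
  case (Inner e t)
  then have "charts z \<subseteq> {(e, t)}"
    by (auto simp: charts_def edge_point_def split: if_splits)
  then show ?thesis using finite_subset by blast
qed

lemma star_radius:
  assumes "z \<in> points"
  obtains r where "0 < r"
    "\<And>e s c. (e, s) \<in> charts z \<Longrightarrow> c \<in> {a e, b e} \<Longrightarrow> c \<noteq> s \<Longrightarrow> r \<le> \<bar>c - s\<bar>"
proof -
  \<comment> \<open>Removing 0 discards the case where \<open>s\<close> is itself an end of the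
    edge. The element 1 keeps the set nonempty, even for a vertex without edges.\<close>
  define R where "R = insert 1
    ((\<lambda>(e, s). \<bar>a e - s\<bar>) ` charts z \<union> (\<lambda>(e, s). \<bar>b e - s\<bar>) ` charts z) - {0}"
  have "finite R" using finite_charts[OF assms] unfolding R_def by blast
  moreover have "1 \<in> R" by (simp add: R_def)
  moreover have "\<forall>\<rho>\<in>R. 0 < \<rho>" by (auto simp: R_def)
  moreover have "\<bar>c - s\<bar> \<in> R" if "(e, s) \<in> charts z" "c \<in> {a e, b e}" "c \<noteq> s" for e s c
    using that by (force simp: R_def)
  ultimately show ?thesis
    by (metis that Min_in Min_le empty_iff)
qed

text \<open>A path too short to reach another end of an edge at \<open>z\<close> stays in the star
  of \<open>z\<close>. The induction follows the distance along the edge to some preimage of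
  \<open>z\<close>, which grows by at most the length travelled.\<close>

lemma joins_within_star:
  assumes r: "\<And>e s c. (e, s) \<in> charts z \<Longrightarrow> c \<in> {a e, b e} \<Longrightarrow> c \<noteq> s \<Longrightarrow> r \<le> \<bar>c - s\<bar>"
  shows "joins p x w \<Longrightarrow> (e, s) \<in> charts z \<Longrightarrow> t \<in> {a e..b e} \<Longrightarrow> x = edge_point e t \<Longrightarrow>
    \<bar>t - s\<bar> + path_length p < r \<Longrightarrow>
    \<exists>e' s' t'. (e', s') \<in> charts z \<and> t' \<in> {a e'..b e'} \<and> w = edge_point e' t' \<and>
      \<bar>t' - s'\<bar> \<le> \<bar>t - s\<bar> + path_length p"
proof (induction p arbitrary: x e s t)
  case Nil
  then show ?case by auto
next
  case (Cons seg p)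
  obtain e1 s1 t1 where seg: "seg = (e1, s1, t1)" by (cases seg)
  with Cons.prems(1) have j: "e1 \<in> arcs G" "s1 \<in> {a e1..b e1}" "t1 \<in> {a e1..b e1}"
    "x = edge_point e1 s1" "joins p (edge_point e1 t1) w" by auto
  have len: "path_length (seg # p) = \<bar>t1 - s1\<bar> + path_length p" by (simp add: seg)
  have "\<exists>s0. (e1, s0) \<in> charts z \<and> \<bar>t1 - s0\<bar> \<le> \<bar>t - s\<bar> + \<bar>t1 - s1\<bar>"
  \<comment> \<open>At an end of \<open>e\<close> the bound by \<open>r\<close> forces
    \<open>t = s\<close>: the path is at \<open>z\<close> and may continue on any edge there, so the
    chart is replaced by \<open>(e1, s1)\<close>. At an inner parameter the next segment must
    continue on \<open>e\<close> from \<open>t\<close>.\<close>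
  proof (cases "t = a e \<or> t = b e")
    case True
    have "\<bar>t - s\<bar> < r" using Cons.prems(5) path_length_nonneg[of "seg # p"] by linarith
    with True r[OF Cons.prems(2), of t] have "t = s" by fastforce
    with Cons.prems j have "(e1, s1) \<in> charts z" by (auto simp: charts_def)
    then show ?thesis by (intro exI[of _ s1]) auto
  next
    case False
    then have "e1 = e" "s1 = t"
      using j(4) Cons.prems(4) by (auto simp: edge_point_def split: if_splits)
    with Cons.prems(2) show ?thesis by (intro exI[of _ s]) auto
  qed
  then obtain s0 where s0: "(e1, s0) \<in> charts z" "\<bar>t1 - s0\<bar> \<le> \<bar>t - s\<bar> + \<bar>t1 - s1\<bar>" by blast
  have "\<bar>t1 - s0\<bar> + path_length p < r" using s0(2) Cons.prems(5) len by linarith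
  from Cons.IH[OF j(5) s0(1) j(3) refl this] obtain e' s' t' where
    "(e', s') \<in> charts z" "t' \<in> {a e'..b e'}" "w = edge_point e' t'"
    "\<bar>t' - s'\<bar> \<le> \<bar>t1 - s0\<bar> + path_length p" by blast
  moreover from this have "\<bar>t' - s'\<bar> \<le> \<bar>t - s\<bar> + path_length (seg # p)"
    using s0(2) len by linarith
  ultimately show ?case by blast
qed

lemma graph_dist_edge_point_le:
  assumes "e \<in> arcs G" "s \<in> {a e..b e}" "t \<in> {a e..b e}"
  shows "graph_dist (edge_point e s) (edge_point e t) \<le> \<bar>t - s\<bar>"
  using graph_dist_le[of "[(e, s, t)]" "edge_point e s" "edge_point e t"] assms by simp

text \<open>Near \<open>z\<close> the infimum defining the distance is attained along a single edge,
  because short paths stay in the star and only finitely many distances along edges compete. The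
  open interval in the conclusion makes every point near \<open>z\<close>, other than
  \<open>z\<close>, an interior point of the graph.\<close>

lemma star_neighbourhood:
  assumes z: "z \<in> points"
  obtains r where "0 < r"
    "\<And>w. w \<in> points \<Longrightarrow> graph_dist z w < r \<Longrightarrow> w \<noteq> z \<Longrightarrow>
       \<exists>e s t. (e, s) \<in> charts z \<and> t \<in> {a e<..<b e} \<and> w = edge_point e t \<and>
         \<bar>t - s\<bar> = graph_dist z w"
proof -
  obtain r where "0 < r" and r: "\<And>e s c. (e, s) \<in> charts z \<Longrightarrow> c \<in> {a e, b e} \<Longrightarrow> c \<noteq> s \<Longrightarrow>
    r \<le> \<bar>c - s\<bar>"
    using star_radius[OF z] by metis
  show ?thesis
  proof (rule that[OF \<open>0 < r\<close>])
    fix w assume w: "w \<in> points" "graph_dist z w < r" "w \<noteq> z"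
    define A where "A = {\<bar>t - s\<bar> | e s t. (e, s) \<in> charts z \<and> (e, t) \<in> charts w}"
    have "A \<subseteq> (\<lambda>((e, s), (e', t)). \<bar>t - s\<bar>) ` (charts z \<times> charts w)"
      unfolding A_def by force
    then have "finite A"
      using finite_charts[OF z] finite_charts[OF w(1)] finite_subset by blast
    have lower: "graph_dist z w \<le> \<alpha>" if "\<alpha> \<in> A" for \<alpha>
      using that graph_dist_edge_point_le by (auto simp: A_def charts_def)
    \<comment> \<open>Inserting \<open>r\<close> covers the paths too long for the star argument and
      makes the minimum meaningful before \<open>A\<close> is known to be nonempty. As
      \<open>graph_dist z w < r\<close>, the minimum is later seen to lie in
      \<open>A\<close>.\<close>
    have "Min (insert r A) \<le> path_length p" if p: "joins p z w" for p
    proof (cases "path_length p < r")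
      case True
      obtain e s t q where pq: "p = (e, s, t) # q"
        using p w(3) by (cases p) auto
      with p have es: "(e, s) \<in> charts z" "s \<in> {a e..b e}" "z = edge_point e s"
        by (auto simp: charts_def)
      have "\<bar>s - s\<bar> + path_length p < r" using True by simp
      from joins_within_star[of z r, OF _ p es this] r obtain e' s' t' where
        "(e', s') \<in> charts z" "t' \<in> {a e'..b e'}" "w = edge_point e' t'"
        "\<bar>t' - s'\<bar> \<le> \<bar>s - s\<bar> + path_length p"
        by blast
      then have "\<bar>t' - s'\<bar> \<in> A" "\<bar>t' - s'\<bar> \<le> path_length p"
        by (auto simp: A_def charts_def)
      with \<open>finite A\<close> have "Min (insert r A) \<le> \<bar>t' - s'\<bar>" by simp
      with \<open>\<bar>t' - s'\<bar> \<le> path_length p\<close> show ?thesis by linarith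
    next
      case False
      moreover have "Min (insert r A) \<le> r" using \<open>finite A\<close> by simp
      ultimately show ?thesis by linarith
    qed
    then have le: "Min (insert r A) \<le> graph_dist z w"
      using z w(1) by (intro graph_dist_ge) auto
    have "Min (insert r A) \<in> insert r A" using \<open>finite A\<close> by (intro Min_in) auto
    with le w(2) have "Min (insert r A) \<in> A" by auto
    with le lower have "graph_dist z w \<in> A" by force
    then obtain e s t where est: "(e, s) \<in> charts z" "(e, t) \<in> charts w" "\<bar>t - s\<bar> = graph_dist z w"
      unfolding A_def by force
    have "t \<noteq> s" using est(1,2) w(3) by (auto simp: charts_def)
    \<comment> \<open>An end of the edge other than \<open>s\<close> would be at distance at least
      \<open>r\<close> from \<open>s\<close>.\<close>
    have "t \<noteq> a e" "t \<noteq> b e"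
      using r[OF est(1), of t] est(3) w(2) \<open>t \<noteq> s\<close> by auto
    with est show "\<exists>e s t. (e, s) \<in> charts z \<and> t \<in> {a e<..<b e} \<and> w = edge_point e t \<and>
        \<bar>t - s\<bar> = graph_dist z w"
      by (intro exI[of _ e] exI[of _ s] exI[of _ t]) (auto simp: charts_def)
  qed
qed

lemma edge_point_interior:
  assumes "e \<in> arcs G" "t \<in> {a e<..<b e}"
  shows "edge_point e t \<in> graph_interior"
  using assms edge_point_in_points[of e t]
  by (auto simp: graph_interior_def graph_boundary_def edge_point_def)

section \<open>The completion of a metric graph\<close>

text \<open>The parametrization of an edge is 1-Lipschitz, though not always isometric since a
  detour may be shorter, and so it carries compactness from the real interval.\<close>

lemma compactin_edge:
  assumes c: "is_completion graph_metric Gbar \<iota>" and e: "e \<in> arcs G"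
  shows "compactin (mtopology_of Gbar) ((\<lambda>t. \<iota> (edge_point e t)) ` {a e..b e})"
proof -
  have iso: "mdist Gbar (\<iota> x) (\<iota> y) = graph_dist x y" if "x \<in> points" "y \<in> points" for x y
    using c that by (simp add: is_completion_def)
  have "Lipschitz_continuous_map (submetric euclidean_metric {a e..b e}) Gbar
      (\<lambda>t. \<iota> (edge_point e t))"
    unfolding Lipschitz_continuous_map_def
  proof (intro conjI exI[of _ 1] ballI)
    show "(\<lambda>t. \<iota> (edge_point e t)) \<in> mspace (submetric euclidean_metric {a e..b e}) \<rightarrow> mspace Gbar"
      using c edge_point_in_points[OF e] by (auto simp: is_completion_def)
    fix s t assume "s \<in> mspace (submetric euclidean_metric {a e..b e})"
      "t \<in> mspace (submetric euclidean_metric {a e..b e})"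
    then show "mdist Gbar (\<iota> (edge_point e s)) (\<iota> (edge_point e t))
        \<le> 1 * mdist (submetric euclidean_metric {a e..b e}) s t"
      using graph_dist_edge_point_le[OF e, of s t] edge_point_in_points[OF e]
      by (auto simp: iso dist_real_def abs_minus_commute)
  qed
  then have "continuous_map (top_of_set {a e..b e}) (mtopology_of Gbar) (\<lambda>t. \<iota> (edge_point e t))"
    by (auto dest: Lipschitz_continuous_imp_continuous_map simp: mtopology_of_submetric)
  moreover have "compactin (top_of_set {a e..b e}) {a e..b e}"
    by (simp add: compactin_subtopology)
  ultimately show ?thesis by (rule image_compactin[rotated])
qed

text \<open>The completion adds no point near \<open>z\<close>: the finitely many edges at
  \<open>z\<close> form a compact, hence closed set containing all graph points of a small ball, and
  these are dense in the ball.\<close>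

lemma completion_star:
  assumes c: "is_completion graph_metric Gbar \<iota>" and z: "z \<in> points"
  obtains r where "0 < r"
    "\<And>w. w \<in> mspace Gbar \<Longrightarrow> mdist Gbar (\<iota> z) w < r \<Longrightarrow> w \<noteq> \<iota> z \<Longrightarrow>
       \<exists>e s t. (e, s) \<in> charts z \<and> t \<in> {a e<..<b e} \<and> w = \<iota> (edge_point e t) \<and>
         \<bar>t - s\<bar> = mdist Gbar (\<iota> z) w"
proof -
  interpret C: Metric_space "mspace Gbar" "mdist Gbar" by (rule Metric_space_mspace_mdist)
  have top: "mtopology_of Gbar = C.mtopology" by (simp add: mtopology_of_def)
  have iso: "\<And>x y. x \<in> points \<Longrightarrow> y \<in> points \<Longrightarrow> mdist Gbar (\<iota> x) (\<iota> y) = graph_dist x y"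
    and \<iota>: "\<And>x. x \<in> points \<Longrightarrow> \<iota> x \<in> mspace Gbar"
    and dense: "C.mtopology closure_of (\<iota> ` points) = mspace Gbar"
    using c by (auto simp: is_completion_def top)
  obtain r where "0 < r" and r: "\<And>w. w \<in> points \<Longrightarrow> graph_dist z w < r \<Longrightarrow> w \<noteq> z \<Longrightarrow>
       \<exists>e s t. (e, s) \<in> charts z \<and> t \<in> {a e<..<b e} \<and> w = edge_point e t \<and>
         \<bar>t - s\<bar> = graph_dist z w"
    using star_neighbourhood[OF z] by metis
  \<comment> \<open>Whole closed edges are taken so that compactness is immediate. Inserting
    \<open>\<iota> z\<close> covers a vertex without edges.\<close>
  define K where "K = insert (\<iota> z) (\<Union>e\<in>fst ` charts z. (\<lambda>t. \<iota> (edge_point e t)) ` {a e..b e})"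
  have arcs: "fst ` charts z \<subseteq> arcs G" by (auto simp: charts_def)
  have "compactin C.mtopology K"
  proof -
    have "compactin C.mtopology (\<Union>e\<in>fst ` charts z. (\<lambda>t. \<iota> (edge_point e t)) ` {a e..b e})"
      using finite_charts[OF z] compactin_edge[OF c] arcs
      by (intro compactin_Union) (auto simp: top)
    moreover have "compactin C.mtopology {\<iota> z}" using \<iota>[OF z] by simp
    ultimately show ?thesis unfolding K_def using compactin_Un by fastforce
  qed
  then have K: "closedin C.mtopology K"
    using compactin_imp_closedin C.Hausdorff_space_mtopology by blast
  have KI: "K \<subseteq> \<iota> ` points"
    using z arcs edge_point_in_points unfolding K_def by blast
  have near: "w \<in> K" if w: "w \<in> mspace Gbar" "mdist Gbar (\<iota> z) w < r" for w
  proof -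
    have "w \<in> C.mball (\<iota> z) r" using w \<iota>[OF z] by simp
    then have "w \<in> C.mtopology closure_of (C.mball (\<iota> z) r \<inter> \<iota> ` points)"
      using openin_Int_closure_of_subset[OF C.openin_mball, of "\<iota> z" r "\<iota> ` points"] w(1) dense
      by blast
    moreover have "C.mball (\<iota> z) r \<inter> \<iota> ` points \<subseteq> K"
    proof
      fix u assume "u \<in> C.mball (\<iota> z) r \<inter> \<iota> ` points"
      then obtain x where x: "x \<in> points" "u = \<iota> x" "graph_dist z x < r" using iso z by auto
      show "u \<in> K"
      proof (cases "x = z")
        case False
        from r[OF x(1,3) False] obtain e s t where
          "(e, s) \<in> charts z" "t \<in> {a e<..<b e}" "x = edge_point e t" by blast
        then have "e \<in> fst ` charts z" "t \<in> {a e..b e}" "u = \<iota> (edge_point e t)"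
          using x by force+
        then show ?thesis unfolding K_def by blast
      qed (simp add: K_def x)
    qed
    ultimately show ?thesis using closure_of_minimal[OF _ K] by blast
  qed
  show ?thesis
  proof (rule that[OF \<open>0 < r\<close>])
    fix w assume w: "w \<in> mspace Gbar" "mdist Gbar (\<iota> z) w < r" "w \<noteq> \<iota> z"
    then obtain x where x: "x \<in> points" "w = \<iota> x" using near KI by blast
    then have "graph_dist z x < r" "x \<noteq> z" using w iso[OF z] by auto
    from r[OF x(1) this] x show "\<exists>e s t. (e, s) \<in> charts z \<and> t \<in> {a e<..<b e} \<and>
        w = \<iota> (edge_point e t) \<and> \<bar>t - s\<bar> = mdist Gbar (\<iota> z) w"
      using iso[OF z x(1)] by auto
  qed
qed

text \<open>The frontier of a small ball lies on its sphere, which meets the star only at parameters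
  \<open>s + \<rho>\<close> and \<open>s - \<rho>\<close> for the finitely many preimages of
  \<open>z\<close>.\<close>

lemma completion_finite_frontier:
  assumes c: "is_completion graph_metric Gbar \<iota>" and z: "z \<in> points"
    and Q: "openin (mtopology_of Gbar) Q" "\<iota> z \<in> Q"
  shows "\<exists>U. openin (mtopology_of Gbar) U \<and> \<iota> z \<in> U \<and> U \<subseteq> Q \<and>
    finite (mtopology_of Gbar frontier_of U) \<and> mtopology_of Gbar frontier_of U \<subseteq> \<iota> ` points"
proof -
  interpret C: Metric_space "mspace Gbar" "mdist Gbar" by (rule Metric_space_mspace_mdist)
  have top: "mtopology_of Gbar = C.mtopology" by (simp add: mtopology_of_def)
  have \<iota>z: "\<iota> z \<in> mspace Gbar" using c z by (auto simp: is_completion_def)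
  obtain r where "0 < r" and r: "\<And>w. w \<in> mspace Gbar \<Longrightarrow> mdist Gbar (\<iota> z) w < r \<Longrightarrow> w \<noteq> \<iota> z \<Longrightarrow>
       \<exists>e s t. (e, s) \<in> charts z \<and> t \<in> {a e<..<b e} \<and> w = \<iota> (edge_point e t) \<and>
         \<bar>t - s\<bar> = mdist Gbar (\<iota> z) w"
    using completion_star[OF c z] by metis
  obtain r' where r': "0 < r'" "C.mball (\<iota> z) r' \<subseteq> Q"
    using Q unfolding top C.openin_mtopology by blast
  \<comment> \<open>Halving makes the radius strictly less than \<open>r\<close>, so the description
    of the star also holds on the sphere.\<close>
  define \<rho> where "\<rho> = min (r / 2) r'"
  have \<rho>: "0 < \<rho>" "\<rho> < r" "\<rho> \<le> r'" using \<open>0 < r\<close> r' by (auto simp: \<rho>_def)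
  define U where "U = C.mball (\<iota> z) \<rho>"
  \<comment> \<open>The parameters may leave the edge, where \<open>edge_point\<close> gives no
    point of the graph. Hence \<open>F\<close> serves only for finiteness, and membership of the
    frontier in the graph is shown separately.\<close>
  define F where "F = (\<lambda>(e, s). \<iota> (edge_point e (s + \<rho>))) ` charts z \<union>
    (\<lambda>(e, s). \<iota> (edge_point e (s - \<rho>))) ` charts z"
  have "C.mtopology frontier_of U = C.mtopology closure_of U - U"
    using frontier_of_openin C.openin_mball unfolding U_def by blast
  moreover have "C.mtopology closure_of U \<subseteq> C.mcball (\<iota> z) \<rho>"
    unfolding U_def by (rule closure_of_minimal[OF C.mball_subset_mcball C.closedin_mcball])
  ultimately have sphere: "w \<in> mspace Gbar \<and> mdist Gbar (\<iota> z) w = \<rho>"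
    if "w \<in> C.mtopology frontier_of U" for w
    using that unfolding U_def by fastforce
  have "w \<in> F \<inter> \<iota> ` points" if fr: "w \<in> C.mtopology frontier_of U" for w
  proof -
    have "w \<noteq> \<iota> z" using sphere[OF fr] \<rho>(1) by auto
    with r[of w] sphere[OF fr] \<rho> obtain e s t where est: "(e, s) \<in> charts z" "t \<in> {a e<..<b e}"
      "w = \<iota> (edge_point e t)" "\<bar>t - s\<bar> = \<rho>" by metis
    from est(4) have "t = s + \<rho> \<or> t = s - \<rho>" by linarith
    with est have "w \<in> F" by (force simp: F_def)
    moreover have "edge_point e t \<in> points"
      using est by (intro edge_point_in_points) (auto simp: charts_def)
    ultimately show ?thesis using est(3) by blast
  qed
  moreover have "finite F" using finite_charts[OF z] by (simp add: F_def)
  ultimately have "finite (C.mtopology frontier_of U)" "C.mtopology frontier_of U \<subseteq> \<iota> ` points"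
    by (blast intro: finite_subset)+
  moreover have "U \<subseteq> Q" using r'(2) \<rho>(3) C.mball_subset_concentric unfolding U_def by blast
  moreover have "\<iota> z \<in> U" using \<iota>z \<rho>(1) by (simp add: U_def)
  ultimately show ?thesis unfolding top using C.openin_mball U_def by blast
qed

text \<open>This serves two purposes: for an interior \<open>z\<close> it makes the image of the
  interior open, and for a vertex of degree 1 it isolates \<open>\<iota> z\<close> in the
  boundary.\<close>

lemma completion_deleted_star_interior:
  assumes c: "is_completion graph_metric Gbar \<iota>" and z: "z \<in> points"
  obtains U where "openin (mtopology_of Gbar) U" "\<iota> z \<in> U" "U \<subseteq> insert (\<iota> z) (\<iota> ` graph_interior)"
proof -
  interpret C: Metric_space "mspace Gbar" "mdist Gbar" by (rule Metric_space_mspace_mdist)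
  obtain r where "0 < r" and r: "\<And>w. w \<in> mspace Gbar \<Longrightarrow> mdist Gbar (\<iota> z) w < r \<Longrightarrow> w \<noteq> \<iota> z \<Longrightarrow>
       \<exists>e s t. (e, s) \<in> charts z \<and> t \<in> {a e<..<b e} \<and> w = \<iota> (edge_point e t) \<and>
         \<bar>t - s\<bar> = mdist Gbar (\<iota> z) w"
    using completion_star[OF c z] by metis
  have "C.mball (\<iota> z) r \<subseteq> insert (\<iota> z) (\<iota> ` graph_interior)"
  proof
    fix w assume w: "w \<in> C.mball (\<iota> z) r"
    show "w \<in> insert (\<iota> z) (\<iota> ` graph_interior)"
    proof (cases "w = \<iota> z")
      case False
      with w r[of w] obtain e s t where est: "(e, s) \<in> charts z" "t \<in> {a e<..<b e}"
        "w = \<iota> (edge_point e t)" by auto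
      then have "edge_point e t \<in> graph_interior"
        by (intro edge_point_interior) (auto simp: charts_def)
      with est(3) show ?thesis by blast
    qed simp
  qed
  moreover have "\<iota> z \<in> mspace Gbar" using c z by (auto simp: is_completion_def)
  then have "\<iota> z \<in> C.mball (\<iota> z) r" using \<open>0 < r\<close> by simp
  ultimately show ?thesis using that C.openin_mball by (metis mtopology_of_def)
qed

lemma closedin_completion_boundary:
  assumes c: "is_completion graph_metric Gbar \<iota>"
  shows "closedin (mtopology_of Gbar) (completion_boundary Gbar \<iota>)"
proof -
  have "openin (mtopology_of Gbar) (\<iota> ` graph_interior)"
  proof (subst openin_subopen, safe)
    fix z assume "z \<in> graph_interior"
    moreover from this have "z \<in> points" by (simp add: graph_interior_def)
    ultimately show "\<exists>T. openin (mtopology_of Gbar) T \<and> \<iota> z \<in> T \<and> T \<subseteq> \<iota> ` graph_interior"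
      using completion_deleted_star_interior[OF c] by (metis image_eqI insert_absorb)
  qed
  then show ?thesis
    unfolding completion_boundary_def
    by (metis closedin_diff closedin_topspace topspace_mtopology_of)
qed

section \<open>The equivalence for the completion of a metric graph\<close>

lemma weakly_connected_iff:
  "weakly_connected Gbar \<iota> \<longleftrightarrow> (\<forall>x\<in>mspace Gbar. \<forall>y\<in>mspace Gbar. x \<noteq> y \<longrightarrow>
     finitely_separated (mtopology_of Gbar) (\<iota> ` points) x y)"
  by (simp add: weakly_connected_def finitely_separated_def)

text \<open>The topological equivalence applies with \<open>S\<close> the image of the graph. Its
  overlap with the boundary consists of the images of the vertices of degree 1.\<close>

lemma totally_disconnected_boundary_iff:
  assumes c: "is_completion graph_metric Gbar \<iota>" and cpt: "compact_space (mtopology_of Gbar)"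
  shows "totally_disconnected_space
      (subtopology (mtopology_of Gbar) (completion_boundary Gbar \<iota>)) \<longleftrightarrow> weakly_connected Gbar \<iota>"
proof -
  show ?thesis
    unfolding weakly_connected_iff topspace_mtopology_of[symmetric]
  proof (rule totally_disconnected_iff_finitely_separated[OF cpt])
    show "Hausdorff_space (mtopology_of Gbar)"
      by (simp add: mtopology_of_def Metric_space.Hausdorff_space_mtopology
          Metric_space_mspace_mdist)
    show "closedin (mtopology_of Gbar) (completion_boundary Gbar \<iota>)"
      by (rule closedin_completion_boundary[OF c])
    show "topspace (mtopology_of Gbar) - completion_boundary Gbar \<iota> \<subseteq> \<iota> ` points"
      by (auto simp: completion_boundary_def graph_interior_def)
    show "\<iota> ` points \<subseteq> topspace (mtopology_of Gbar)"
      using c by (auto simp: is_completion_def)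
    show "\<exists>U. openin (mtopology_of Gbar) U \<and> z \<in> U \<and> U \<subseteq> Q \<and>
        finite (mtopology_of Gbar frontier_of U) \<and> mtopology_of Gbar frontier_of U \<subseteq> \<iota> ` points"
      if "z \<in> \<iota> ` points" "openin (mtopology_of Gbar) Q" "z \<in> Q" for z Q
      using that completion_finite_frontier[OF c] by blast
    fix z assume z: "z \<in> \<iota> ` points \<inter> completion_boundary Gbar \<iota>"
    then obtain z' where "z' \<in> points" "z = \<iota> z'" by blast
    with completion_deleted_star_interior[OF c] obtain U where
      "openin (mtopology_of Gbar) U" "z \<in> U" "U \<subseteq> insert z (\<iota> ` graph_interior)" by metis
    moreover from this have "U \<inter> completion_boundary Gbar \<iota> = {z}"
      using z unfolding completion_boundary_def by blast
    ultimately show "\<exists>U. openin (mtopology_of Gbar) U \<and> U \<inter> completion_boundary Gbar \<iota> = {z}"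
      by blast
  qed
qed

end

theorem theorem2p2:
  fixes G :: "('v, 'e) pre_digraph"
    and a b :: "'e \<Rightarrow> real"
    and Gbar :: "'c metric"
    and \<iota> :: "('v, 'e) graph_point \<Rightarrow> 'c"
  assumes "metric_graph G a b"
    and "is_completion (metric_graph.graph_metric G a b) Gbar \<iota>"
    and "compact_space (mtopology_of Gbar)"
  shows "totally_disconnected_space
           (subtopology (mtopology_of Gbar) (metric_graph.completion_boundary G a b Gbar \<iota>))
         \<longleftrightarrow> metric_graph.weakly_connected G a b Gbar \<iota>"
  using assms by (rule metric_graph.totally_disconnected_boundary_iff)

end
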